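(* Let $n\ge 2$, $m\ge 1$ be integers, let $\Phi$ be a radial function on $\mathbb{R}^n$, let $1\le p,\tilde p_1,\tilde p_2<\infty$ and $\beta=n(m-1)$. Then, for every $F\in L^{p}_{\rm rad}L^{\tilde p_2}_{\rm ang}(\mathbb{R}^{nm})$, $$\|H_{\Phi}F\|_{L^{p}_{\rm rad}L^{\tilde p_1}_{\rm ang}(\mathbb{R}^n,r^\beta)}\le \omega_{n-1}^{\frac{1}{\tilde p_1}}\,\omega_{nm-1}^{\frac{1}{\tilde p_2'}}\int_0^\infty \frac{|\Phi(t)|}{t}\,t^{\frac{nm}{p}}\,dt\;\|F\|_{L^{p}_{\rm rad}L^{\tilde p_2}_{\rm ang}(\mathbb{R}^{nm})} .$$
   Context: For $N\ge2$, $S^{N-1}$ is the unit sphere of $\mathbb{R}^N$ with (unnormalized) surface Lebesgue measure $d\sigma$, and $\omega_{N-1}=\sigma(S^{N-1})$. For $1\le p,\tilde p<\infty$ and a weight $w$ on $(0,\infty)$, $$\|f\|_{L^{p}_{\rm rad}L^{\tilde p}_{\rm ang}(\mathbb{R}^N,w)}=\Big(\int_0^\infty\Big(\int_{S^{N-1}}|f(r\theta)|^{\tilde p}d\sigma(\theta)\Big)^{p/\tilde p}r^{N-1}w(r)\,dr\Big)^{1/p};$$ $w$ is omitted from the notation when $w\equiv1$, and $r^\beta$ denotes the weight $w(r)=r^\beta$. For a locally integrable $F$ on $\mathbb{R}^{nm}$, the Hausdorff operator (mapping functions on $\mathbb{R}^{nm}$ to functions on $\mathbb{R}^n$) is $$H_\Phi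 F(x)=\int_{\mathbb{R}^{nm}}\frac{\Phi(x|y|^{-1})}{|y|^{nm}}F(y)\,dy,\qquad x\in\mathbb{R}^n,$$ where $|y|$ is the Euclidean norm in $\mathbb{R}^{nm}$. $\Phi$ is measurable; radial means $\Phi(x)$ depends only on $|x|$, and one writes $\Phi(t)$, $t>0$, for its value at points with $|x|=t$. $\tilde p_2'$ is the conjugate exponent: $1/\tilde p_2+1/\tilde p_2'=1$. The inequality has content when the integral constant on the right is finite. *)

theory Defs
  imports "HOL-Analysis.Analysis"
begin

(* The unnormalized surface measure on the unit sphere S^(N-1), given by the usual cone formula:
   the surface measure of A is N times the Lebesgue measure of the cone {r * v | v in A, 0 < r <= 1}.
   Here sgn x = x / |x|.  The measure space is the sphere itself, with its Borel sets. *)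
definition surface_measure :: "'a::euclidean_space measure" where
  "surface_measure =
     scale_measure (of_nat DIM('a))
       (distr (restrict_space lborel (cball 0 1 - {0})) (restrict_space borel (sphere 0 1)) sgn)"

(* With N = DIM('a), this is the number written omega_(N-1). *)
definition sphere_area :: "'a::euclidean_space itself \<Rightarrow> real" where
  "sphere_area _ = measure (surface_measure :: 'a measure) (sphere 0 1)"

lemma space_surface_measure: "space (surface_measure :: 'a::euclidean_space measure) = sphere 0 1"
  by (simp add: surface_measure_def space_scale_measure space_restrict_space)

lemma sets_surface_measure:
  "sets (surface_measure :: 'a::euclidean_space measure) = sets (restrict_space borel (sphere 0 1))"
  by (simp add: surface_measure_def)

lemma measurable_sgn_sphere:
  "(sgn :: 'a::euclidean_space \<Rightarrow> 'a)
     \<in> restrict_space lborel (cball 0 1 - {0}) \<rightarrow>\<^sub>M restrict_space borel (sphere 0 1)"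
proof (rule measurable_restrict_space2)
  show "(sgn :: 'a \<Rightarrow> 'a) \<in> space (restrict_space lborel (cball 0 1 - {0})) \<rightarrow> sphere 0 1"
    by (auto simp: space_restrict_space norm_sgn)
  have "(sgn :: 'a \<Rightarrow> 'a) \<in> borel_measurable borel"
    unfolding sgn_div_norm by measurable
  then show "(sgn :: 'a \<Rightarrow> 'a) \<in> restrict_space lborel (cball 0 1 - {0}) \<rightarrow>\<^sub>M borel"
    by (intro measurable_restrict_space1) simp
qed

lemma emeasure_surface_measure:
  fixes A :: "'a::euclidean_space set"
  assumes "A \<in> sets borel" "A \<subseteq> sphere 0 1"
  shows "emeasure surface_measure A =
           of_nat DIM('a) * emeasure lborel {x. 0 < norm x \<and> norm x \<le> 1 \<and> sgn x \<in> A}"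
proof -
  have "A \<in> sets (restrict_space borel (sphere 0 1))"
    using assms by (auto simp: sets_restrict_space_iff)
  moreover have "sgn -` A \<inter> (cball 0 1 - {0}) = {x. 0 < norm x \<and> norm x \<le> 1 \<and> sgn x \<in> A}"
    by auto
  moreover have "emeasure (restrict_space lborel (cball 0 1 - {0})) {x. 0 < norm x \<and> norm x \<le> 1 \<and> sgn x \<in> A}
      = emeasure lborel {x. 0 < norm x \<and> norm x \<le> 1 \<and> sgn x \<in> A}"
    by (rule emeasure_restrict_space) auto
  ultimately show ?thesis
    by (simp add: surface_measure_def emeasure_distr measurable_sgn_sphere space_restrict_space)
qed

lemma sphere_area_eq: "sphere_area TYPE('a::euclidean_space) = DIM('a) * unit_ball_vol DIM('a)"
proof -
  have "{x :: 'a. 0 < norm x \<and> norm x \<le> 1 \<and> sgn x \<in> sphere 0 1} = cball 0 1 - {0}"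
    by (auto simp: norm_sgn)
  moreover have "emeasure lborel (cball 0 1 - {0 :: 'a}) = emeasure lborel (cball (0 :: 'a) 1)"
    by (rule emeasure_Diff_null_set) auto
  ultimately show ?thesis
    by (simp add: sphere_area_def measure_def emeasure_surface_measure emeasure_cball enn2real_mult)
qed

(* Powers of extended nonnegative reals; only used with exponents a > 0. *)
definition ennpowr :: "ennreal \<Rightarrow> real \<Rightarrow> ennreal" where
  "ennpowr x a = (if x = \<infinity> then \<infinity> else ennreal (enn2real x powr a))"

(* The norm of L^p_rad L^q_ang(R^N, w), with value infinity when f is not in the space.
   The integrals over lborel and over lebesgue agree here (nn_integral_completion). *)
definition rad_ang_norm ::
  "real \<Rightarrow> real \<Rightarrow> (real \<Rightarrow> real) \<Rightarrow> ('a::euclidean_space \<Rightarrow> complex) \<Rightarrow> ennreal" where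
  "rad_ang_norm p q w f =
     ennpowr
       (\<integral>\<^sup>+ r \<in> {0<..}.
          ennpowr (\<integral>\<^sup>+ \<theta>. ennreal (cmod (f (r *\<^sub>R \<theta>)) powr q) \<partial>surface_measure) (p / q)
          * ennreal (r ^ (DIM('a) - 1) * w r) \<partial>lborel)
       (1 / p)"

definition rad_ang_space ::
  "real \<Rightarrow> real \<Rightarrow> (real \<Rightarrow> real) \<Rightarrow> ('a::euclidean_space \<Rightarrow> complex) set" where
  "rad_ang_space p q w = {f \<in> borel_measurable lebesgue. rad_ang_norm p q w f < \<infinity>}"

definition radial :: "('a::euclidean_space \<Rightarrow> complex) \<Rightarrow> bool" where
  "radial \<Phi> \<longleftrightarrow> (\<forall>x y. norm x = norm y \<longrightarrow> \<Phi> x = \<Phi> y)"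

(* For radial \<Phi> and t > 0, the value written \<Phi>(t). *)
definition radial_value :: "('a::euclidean_space \<Rightarrow> complex) \<Rightarrow> real \<Rightarrow> complex" where
  "radial_value \<Phi> t = (THE c. \<forall>x. norm x = t \<longrightarrow> \<Phi> x = c)"

lemma radial_value_norm: "radial \<Phi> \<Longrightarrow> radial_value \<Phi> (norm x) = \<Phi> x"
  unfolding radial_value_def radial_def by (rule the_equality) blast+

definition hausdorff_integrand ::
  "('a::euclidean_space \<Rightarrow> complex) \<Rightarrow> ('b::euclidean_space \<Rightarrow> complex) \<Rightarrow> 'a \<Rightarrow> 'b \<Rightarrow> complex" where
  "hausdorff_integrand \<Phi> F x y = \<Phi> (x /\<^sub>R norm y) / of_real (norm y ^ DIM('b)) * F y"

definition hausdorff_op ::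
  "('a::euclidean_space \<Rightarrow> complex) \<Rightarrow> ('b::euclidean_space \<Rightarrow> complex) \<Rightarrow> 'a \<Rightarrow> complex" where
  "hausdorff_op \<Phi> F x = (LINT y|lebesgue. hausdorff_integrand \<Phi> F x y)"

(* The integral of |\<Phi>(t)| / t * t^a over t > 0. *)
definition hausdorff_const :: "('a::euclidean_space \<Rightarrow> complex) \<Rightarrow> real \<Rightarrow> ennreal" where
  "hausdorff_const \<Phi> a =
     (\<integral>\<^sup>+ t \<in> {0<..}. ennreal (cmod (radial_value \<Phi> t) / t * t powr a) \<partial>lborel)"

end

theory Submission
  imports Defs
begin

text \<open>In polar coordinates a radial kernel turns \<open>|H\<^sub>\<Phi> F(x)|\<close>, for \<open>|x| = \<rho>\<close>, into at most
  \<open>g(\<rho>) = \<integral> |\<Phi>(\<rho>/s)| G(s) ds/s\<close>, where \<open>G(s)\<close> is the integral of \<open>|F(s \<theta>)|\<close> over the unit sphere of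
  the domain. With \<open>a = nm/p\<close>, the function \<open>\<rho>\<^sup>a g(\<rho>)\<close> is the convolution of \<open>t\<^sup>a |\<Phi>(t)|\<close> and
  \<open>s\<^sup>a G(s)\<close> on the multiplicative group of positive reals with Haar measure \<open>dt/t\<close>, so Young's
  inequality for \<open>L\<^sup>1 * L\<^sup>p\<close> bounds its \<open>p\<close>-norm. The weight \<open>r\<^sup>\<beta>\<close> is what makes the radial density
  \<open>r^(n - 1) * r\<^sup>\<beta>\<close> of the target equal to \<open>r^(nm - 1)\<close>. Hoelder's inequality on the sphere
  passes from \<open>G\<close> to the \<open>p\<^sub>2\<close>-norm in the angle, and the bound of \<open>H\<^sub>\<Phi> F\<close> by the
  function \<open>g\<close> of the radius alone costs only the area of the sphere in \<open>\<real>\<^sup>n\<close>.\<close>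

subsection \<open>Powers of extended nonnegative reals\<close>

lemma ennpowr_ennreal: "0 \<le> x \<Longrightarrow> ennpowr (ennreal x) a = ennreal (x powr a)"
  by (simp add: ennpowr_def)

lemma ennpowr_top [simp]: "ennpowr top a = top"
  by (simp add: ennpowr_def)

lemma ennpowr_0 [simp]: "ennpowr 0 a = 0"
  by (simp add: ennpowr_def)

lemma ennpowr_eq_0_iff [simp]: "ennpowr x a = 0 \<longleftrightarrow> x = 0"
  by (cases x) (auto simp: ennpowr_ennreal ennreal_eq_0_iff powr_def)

lemma ennpowr_eq_top_iff [simp]: "ennpowr x a = top \<longleftrightarrow> x = top"
  by (cases x) (auto simp: ennpowr_ennreal)

lemma ennpowr_mono: "x \<le> y \<Longrightarrow> 0 \<le> a \<Longrightarrow> ennpowr x a \<le> ennpowr y a"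
  by (cases x; cases y) (auto simp: ennpowr_ennreal powr_mono2 top_unique intro!: ennreal_leI)

lemma ennpowr_1 [simp]: "ennpowr x 1 = x"
  by (cases x) (auto simp: ennpowr_ennreal)

text \<open>The conventions that 0 and \<open>top\<close> are fixed by every exponent, including 0,
  make the laws of exponents hold for all values without sign conditions; in particular
  \<open>0 * top = 0\<close> is respected by products.\<close>

lemma ennpowr_ennpowr: "ennpowr (ennpowr x a) b = ennpowr x (a * b)"
  by (cases x) (auto simp: ennpowr_ennreal powr_powr)

lemma ennpowr_mult: "ennpowr (x * y) a = ennpowr x a * ennpowr y a"
  by (cases x; cases y)
    (auto simp: ennpowr_ennreal powr_mult ennreal_mult_top ennreal_top_mult ennreal_eq_0_iff
      simp flip: ennreal_mult)

lemma ennpowr_add: "ennpowr x (a + b) = ennpowr x a * ennpowr x b"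
  by (cases x) (auto simp: ennpowr_ennreal powr_add simp flip: ennreal_mult)

lemma measurable_ennpowr [measurable (raw)]:
  "f \<in> borel_measurable M \<Longrightarrow> (\<lambda>x. ennpowr (f x) a) \<in> borel_measurable M"
  unfolding ennpowr_def
  by (rule measurable_If) (auto intro!: measurable_compose[OF _ measurable_ennreal] powr_real_measurable)

section \<open>Jensen's inequality for powers over a finite measure\<close>

lemma powr_tangent_le:
  fixes h c p :: real
  assumes "0 \<le> h" "0 < c" "1 \<le> p"
  shows "p * c powr (p - 1) * h \<le> h powr p + (p - 1) * c powr p"
proof (cases "p = 1")
  case False
  then have p: "1 < p" using assms by simp
  \<comment> \<open>Convexity of the power is obtained from Young's inequality with the conjugate
    exponents \<open>p\<close> and \<open>p / (p - 1)\<close>; the second one forces the separate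
    treatment of \<open>p = 1\<close>.\<close>
  have "h * c powr (p - 1) \<le> h powr p / p + (c powr (p - 1)) powr (p / (p - 1)) / (p / (p - 1))"
    using p assms by (intro Youngs_inequality) (auto simp: field_simps)
  also have "(c powr (p - 1)) powr (p / (p - 1)) = c powr p"
    using p by (simp add: powr_powr)
  finally have "h * c powr (p - 1) \<le> (h powr p + (p - 1) * c powr p) / p"
    by (simp add: add_divide_distrib mult.commute)
  then show ?thesis
    using p by (simp add: pos_le_divide_eq ac_simps)
qed (use assms in auto)

text \<open>This is Jensen's inequality for a measure that is not normalized, or Hoelder's
  inequality against the constant 1. Integrating the tangent inequality at a free point
  \<open>c\<close> gives a family of bounds that are linear in the integral of \<open>f\<close>, and
  the best \<open>c\<close> is the mean of \<open>f\<close>.\<close>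

lemma nn_integral_power_mean:
  assumes [measurable]: "f \<in> borel_measurable M" and fin: "emeasure M (space M) < \<infinity>" and p: "1 \<le> p"
  shows "ennpowr (\<integral>\<^sup>+ x. f x \<partial>M) p \<le> ennpowr (emeasure M (space M)) (p - 1) * (\<integral>\<^sup>+ x. ennpowr (f x) p \<partial>M)"
proof (cases "emeasure M (space M) = 0")
  case True
  then have "(\<integral>\<^sup>+ x. f x \<partial>M) = 0"
    by (metis ae_filter_eq_bot_iff nn_integral_0_iff_AE assms(1) eventually_bot trivial_limit_def)
  then show ?thesis by simp
next
  case False
  define K where "K = measure M (space M)"
  have K: "emeasure M (space M) = ennreal K" "0 < K"
    using False fin emeasure_eq_ennreal_measure[of M "space M"]
    by (auto simp: K_def less_top measure_nonneg intro!: order.not_eq_order_implies_strict)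
  have tangent: "ennreal (p * c powr (p - 1)) * (\<integral>\<^sup>+ x. f x \<partial>M)
      \<le> (\<integral>\<^sup>+ x. ennpowr (f x) p \<partial>M) + ennreal ((p - 1) * c powr p * K)" if c: "0 < c" for c
  proof -
    have "ennreal (p * c powr (p - 1)) * f x \<le> ennpowr (f x) p + ennreal ((p - 1) * c powr p)" for x
    proof (cases "f x")
      case (real h)
      then show ?thesis
        using powr_tangent_le[of h c p] c p
        by (auto simp: ennpowr_ennreal simp flip: ennreal_mult ennreal_plus intro!: ennreal_leI)
    qed auto
    then have "(\<integral>\<^sup>+ x. ennreal (p * c powr (p - 1)) * f x \<partial>M)
        \<le> (\<integral>\<^sup>+ x. ennpowr (f x) p + ennreal ((p - 1) * c powr p) \<partial>M)"
      by (intro nn_integral_mono)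
    then show ?thesis
      using p c K by (simp add: nn_integral_cmult nn_integral_add flip: ennreal_mult)
  qed
  show ?thesis
  proof (cases "\<integral>\<^sup>+ x. f x \<partial>M")
    case (real I)
    show ?thesis
    proof (cases "\<integral>\<^sup>+ x. ennpowr (f x) p \<partial>M")
      case (real J)
      show ?thesis
      proof (cases "I = 0")
        case False
        \<comment> \<open>The tangent is taken at the mean value of \<open>f\<close>; then
          \<open>I = c * K\<close>, and the two terms containing \<open>p\<close> cancel.\<close>
        define c where "c = I / K"
        have c: "0 < c" using False \<open>0 \<le> I\<close> K by (simp add: c_def)
        have I: "I = c * K" using K by (simp add: c_def)
        have "ennreal (p * c powr (p - 1) * I) \<le> ennreal (J + (p - 1) * c powr p * K)"
          using tangent[OF c] real \<open>0 \<le> I\<close> \<open>integral\<^sup>N M f = ennreal I\<close> p K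
          by (simp flip: ennreal_mult ennreal_plus)
        then have "p * c powr (p - 1) * I \<le> J + (p - 1) * c powr p * K"
          using real p K by (subst (asm) ennreal_le_iff) auto
        moreover have "c powr (p - 1) * I = c powr p * K"
          using c I by (simp add: powr_diff)
        ultimately have "c powr p * K \<le> J"
          by (simp add: left_diff_distrib mult.assoc)
        then have "K powr (p - 1) * (c powr p * K) \<le> K powr (p - 1) * J"
          by (intro mult_left_mono) auto
        also have "K powr (p - 1) * (c powr p * K) = I powr p"
          using K c by (simp add: I powr_mult powr_diff)
        finally show ?thesis
          using real \<open>0 \<le> I\<close> \<open>integral\<^sup>N M f = ennreal I\<close> K
          by (simp add: ennpowr_ennreal flip: ennreal_mult)
      qed (simp add: \<open>integral\<^sup>N M f = ennreal I\<close>)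
    qed (use K in \<open>auto simp: ennreal_mult_top\<close>)
  next
    case top
    \<comment> \<open>With infinite integral of \<open>f\<close>, any tangent will do: at
      \<open>c = 1\<close> the left side is infinite while the added constant
      \<open>(p - 1) * K\<close> is finite.\<close>
    then have "(\<integral>\<^sup>+ x. ennpowr (f x) p \<partial>M) = top"
      using tangent[of 1] p by (auto simp: ennreal_mult_top top_unique)
    then show ?thesis
      using K by (auto simp: ennreal_mult_top)
  qed
qed

subsection \<open>Haar measure on the multiplicative group of positive reals\<close>

text \<open>The measure dt/t is kept on the whole real line, with no mass outside the positive
  reals, so that positivity becomes an almost-everywhere condition and measurability is plain Borel
  measurability on the line.\<close>

definition mult_haar :: "real measure" where
  "mult_haar = density lborel (\<lambda>t. ennreal (indicator {0<..} t / t))"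

lemma sets_mult_haar [measurable_cong, simp]: "sets mult_haar = sets borel"
  by (simp add: mult_haar_def)

lemma space_mult_haar [simp]: "space mult_haar = UNIV"
  by (simp add: mult_haar_def)

lemma AE_mult_haar: "(AE t in mult_haar. P t) \<longleftrightarrow> (AE t in lborel. 0 < t \<longrightarrow> P t)"
  unfolding mult_haar_def
  by (subst AE_density) (auto intro!: AE_cong simp: indicator_def)

lemma nn_integral_mult_haar:
  assumes [measurable]: "f \<in> borel_measurable borel"
  shows "(\<integral>\<^sup>+ t. f t \<partial>mult_haar) = (\<integral>\<^sup>+ t \<in> {0<..}. f t * ennreal (1 / t) \<partial>lborel)"
  unfolding mult_haar_def
  by (subst nn_integral_density) (auto intro!: nn_integral_cong simp: indicator_def mult.commute)

lemma sigma_finite_mult_haar: "sigma_finite_measure mult_haar"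
  unfolding mult_haar_def 
  by (subst sigma_finite_measure.sigma_finite_iff_density_finite[OF lborel.sigma_finite_measure_axioms]) auto

interpretation mult_haar: sigma_finite_measure mult_haar
  by (rule sigma_finite_mult_haar)

text \<open>The factor \<open>c\<close> from the affine change of variables cancels against the
  density \<open>1 / (c * t)\<close>: this is the invariance that characterizes Haar
  measure.\<close>

lemma nn_integral_mult_haar_scale:
  assumes [measurable]: "f \<in> borel_measurable borel" and c: "0 < c"
  shows "(\<integral>\<^sup>+ t. f (c * t) \<partial>mult_haar) = (\<integral>\<^sup>+ t. f t \<partial>mult_haar)"
proof -
  have "(\<integral>\<^sup>+ t. f t \<partial>mult_haar)
      = ennreal c * (\<integral>\<^sup>+ t \<in> {0<..}. f (c * t) * ennreal (1 / (c * t)) \<partial>lborel)"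
    using c by (simp add: nn_integral_mult_haar)
      (subst nn_integral_real_affine[where c = c and t = 0], auto simp: indicator_def zero_less_mult_iff intro!: nn_integral_cong arg_cong2[where f = "(*)"])
  also have "\<dots> = (\<integral>\<^sup>+ t \<in> {0<..}. f (c * t) * ennreal (1 / t) \<partial>lborel)"
  proof (subst nn_integral_cmult[symmetric], measurable, intro nn_integral_cong)
    fix t :: real
    have "ennreal c * (ennreal (1 / (c * t)) * f (c * t)) = ennreal (1 / t) * f (c * t)" if "0 < t"
      using c that by (simp add: mult.assoc[symmetric] flip: ennreal_mult)
    then show "ennreal c * (f (c * t) * ennreal (1 / (c * t)) * indicator {0<..} t) =
        f (c * t) * ennreal (1 / t) * indicator {0<..} t"
      by (cases "0 < t") (simp_all add: mult_ac)
  qed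
  finally show ?thesis
    by (simp add: nn_integral_mult_haar)
qed

text \<open>Swapping the order of integration reduces the inversion to dilations, at the price of a
  factor that is the finite nonzero measure of \<open>{1..2}\<close>.\<close>

lemma nn_integral_mult_haar_inverse:
  assumes [measurable]: "f \<in> borel_measurable borel"
  shows "(\<integral>\<^sup>+ t. f (1 / t) \<partial>mult_haar) = (\<integral>\<^sup>+ t. f t \<partial>mult_haar)"
proof -
  interpret pair_sigma_finite mult_haar mult_haar ..
  define u :: "real \<Rightarrow> ennreal" where "u = indicator {1..2}"
  have [measurable]: "u \<in> borel_measurable borel" by (simp add: u_def)
  define U where "U = (\<integral>\<^sup>+ t. u t \<partial>mult_haar)"
  have AE_pos: "AE t in mult_haar. 0 < t" by (simp add: AE_mult_haar)
  have "(\<integral>\<^sup>+ t. f (1 / t) \<partial>mult_haar) * U = (\<integral>\<^sup>+ t. (\<integral>\<^sup>+ s. f (1 / s) * u t \<partial>mult_haar) \<partial>mult_haar)"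
    by (simp add: U_def nn_integral_cmult nn_integral_multc)
  also have "\<dots> = (\<integral>\<^sup>+ t. (\<integral>\<^sup>+ s. f (t / s) * u t \<partial>mult_haar) \<partial>mult_haar)"
  proof (rule nn_integral_cong_AE, use AE_pos in eventually_elim)
    case (elim t)
    then show ?case
      using nn_integral_mult_haar_scale[of "\<lambda>s. f (1 / s) * u t" "1 / t"] by simp
  qed
  also have "\<dots> = (\<integral>\<^sup>+ s. (\<integral>\<^sup>+ t. f (t / s) * u t \<partial>mult_haar) \<partial>mult_haar)"
    by (rule Fubini') measurable
  also have "\<dots> = (\<integral>\<^sup>+ s. (\<integral>\<^sup>+ t. f t * u (s * t) \<partial>mult_haar) \<partial>mult_haar)"
  proof (rule nn_integral_cong_AE, use AE_pos in eventually_elim)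
    case (elim s)
    then show ?case
      using nn_integral_mult_haar_scale[of "\<lambda>t. f (t / s) * u t" s] by simp
  qed
  also have "\<dots> = (\<integral>\<^sup>+ t. (\<integral>\<^sup>+ s. f t * u (s * t) \<partial>mult_haar) \<partial>mult_haar)"
    by (rule Fubini') measurable
  also have "\<dots> = (\<integral>\<^sup>+ t. (\<integral>\<^sup>+ s. f t * u s \<partial>mult_haar) \<partial>mult_haar)"
  proof (rule nn_integral_cong_AE, use AE_pos in eventually_elim)
    case (elim t)
    then show ?case
      using nn_integral_mult_haar_scale[of "\<lambda>s. f t * u s" t] by (simp add: mult.commute)
  qed
  also have "\<dots> = (\<integral>\<^sup>+ t. f t \<partial>mult_haar) * U"
    by (simp add: U_def nn_integral_cmult nn_integral_multc)
  finally have *: "(\<integral>\<^sup>+ t. f (1 / t) \<partial>mult_haar) * U = (\<integral>\<^sup>+ t. f t \<partial>mult_haar) * U" .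
  have "U \<le> (\<integral>\<^sup>+ t. indicator {1..2::real} t \<partial>lborel)"
    unfolding U_def
    by (subst nn_integral_mult_haar) (auto simp: u_def indicator_def simp del: nn_integral_indicator intro!: nn_integral_mono)
  then have "U \<noteq> top" by (auto simp: top_unique)
  moreover have "U \<noteq> 0"
  proof
    assume "U = 0"
    then have "AE t in mult_haar. u t = 0"
      unfolding U_def by (subst (asm) nn_integral_0_iff_AE) auto
    then have "AE t in lborel. t \<notin> {1..2::real}"
      unfolding AE_mult_haar by eventually_elim (auto simp: u_def indicator_def split: if_splits)
    then have "emeasure lborel {1..2::real} = 0"
      by (subst (asm) AE_iff_measurable[of "{1..2}"]) auto
    then show False by simp
  qed
  ultimately show ?thesis
    using * by (simp add: ennreal_mult_cancel_left mult.commute[of _ U])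
qed

lemma nn_integral_mult_haar_divide:
  assumes [measurable]: "f \<in> borel_measurable borel" and c: "0 < c"
  shows "(\<integral>\<^sup>+ t. f (c / t) \<partial>mult_haar) = (\<integral>\<^sup>+ t. f t \<partial>mult_haar)"
  using nn_integral_mult_haar_inverse[of "\<lambda>t. f (c * t)"] nn_integral_mult_haar_scale[OF assms] by simp

text \<open>Inversion followed by a dilation preserves the measure, hence its null sets. Since
  \<open>P\<close> need not be measurable, the argument runs through a Borel null set containing the
  exceptional points.\<close>

lemma AE_mult_haar_divide:
  assumes "AE t in mult_haar. P t" and c: "0 < c"
  shows "AE t in mult_haar. P (c / t)"
proof -
  obtain N where N: "{t. \<not> P t} \<subseteq> N" "N \<in> sets borel" "emeasure mult_haar N = 0"
    using AE_E[OF assms(1)] by auto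
  have [measurable]: "N \<in> sets borel" by fact
  have "(\<integral>\<^sup>+ t. indicator N (c / t) \<partial>mult_haar) = 0"
    using nn_integral_mult_haar_divide[of "indicator N" c] N c by simp
  then have "AE t in mult_haar. (indicator N (c / t) :: ennreal) = 0"
    by (subst (asm) nn_integral_0_iff_AE) auto
  then show ?thesis
    by eventually_elim (use N in \<open>auto simp: indicator_def split: if_splits\<close>)
qed

text \<open>This is Young's inequality for the convolution of an L^1 and an L^p function. For fixed
  \<open>\<rho>\<close> the measure with density \<open>k (\<rho> / s)\<close> has total mass
  \<open>K\<close> by invariance under inversion and dilation, so Jensen's inequality applies to it;
  Tonelli and dilation invariance in \<open>\<rho>\<close> then yield one more factor
  \<open>K\<close>.\<close>

theorem nn_integral_mult_haar_convolution:
  assumes [measurable]: "k \<in> borel_measurable borel" "h \<in> borel_measurable borel" and p: "1 \<le> p"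
  shows "(\<integral>\<^sup>+ \<rho>. ennpowr (\<integral>\<^sup>+ s. k (\<rho> / s) * h s \<partial>mult_haar) p \<partial>mult_haar)
    \<le> ennpowr (\<integral>\<^sup>+ t. k t \<partial>mult_haar) p * (\<integral>\<^sup>+ s. ennpowr (h s) p \<partial>mult_haar)"
proof -
  interpret pair_sigma_finite mult_haar mult_haar ..
  define K where "K = (\<integral>\<^sup>+ t. k t \<partial>mult_haar)"
  have AE_pos: "AE t in mult_haar. 0 < t" by (simp add: AE_mult_haar)
  \<comment> \<open>Jensen's inequality needs finite total mass. If \<open>K\<close> is infinite, so
    is the right side, unless \<open>h\<close> vanishes almost everywhere, when both sides are
    0.\<close>
  consider "K < \<infinity>" | "(\<integral>\<^sup>+ s. ennpowr (h s) p \<partial>mult_haar) = 0"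
    | "K = \<infinity>" "(\<integral>\<^sup>+ s. ennpowr (h s) p \<partial>mult_haar) \<noteq> 0"
    by (cases "K = \<infinity>") (auto simp: less_top)
  then show ?thesis
  proof cases
    case 1
    have "(\<integral>\<^sup>+ \<rho>. ennpowr (\<integral>\<^sup>+ s. k (\<rho> / s) * h s \<partial>mult_haar) p \<partial>mult_haar)
        \<le> (\<integral>\<^sup>+ \<rho>. (\<integral>\<^sup>+ s. ennpowr K (p - 1) * (k (\<rho> / s) * ennpowr (h s) p) \<partial>mult_haar) \<partial>mult_haar)"
    proof (rule nn_integral_mono_AE, use AE_pos in eventually_elim)
      case (elim \<rho>)
      let ?D = "density mult_haar (\<lambda>s. k (\<rho> / s))"
      have K: "emeasure ?D (space ?D) = K"
        using nn_integral_mult_haar_divide[of k \<rho>] elim by (simp add: emeasure_density K_def)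
      then have "ennpowr (\<integral>\<^sup>+ s. h s \<partial>?D) p \<le> ennpowr K (p - 1) * (\<integral>\<^sup>+ s. ennpowr (h s) p \<partial>?D)"
        using nn_integral_power_mean[of h ?D p] 1 p by simp
      then show ?case
        by (simp add: nn_integral_density nn_integral_cmult)
    qed
    also have "\<dots> = (\<integral>\<^sup>+ s. (\<integral>\<^sup>+ \<rho>. ennpowr K (p - 1) * (k (\<rho> / s) * ennpowr (h s) p) \<partial>mult_haar) \<partial>mult_haar)"
      by (rule Fubini') measurable
    also have "\<dots> = (\<integral>\<^sup>+ s. ennpowr K (p - 1) * (K * ennpowr (h s) p) \<partial>mult_haar)"
    proof (rule nn_integral_cong_AE, use AE_pos in eventually_elim)
      case (elim s)
      then show ?case
        using nn_integral_mult_haar_scale[of k "1 / s"]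
        by (simp add: nn_integral_cmult nn_integral_multc K_def)
    qed
    also have "\<dots> = ennpowr K p * (\<integral>\<^sup>+ s. ennpowr (h s) p \<partial>mult_haar)"
      using ennpowr_add[of K "p - 1" 1] by (simp add: nn_integral_cmult mult.assoc)
    finally show ?thesis by (simp add: K_def)
  next
    case 2
    then have "AE s in mult_haar. h s = 0"
      by (subst (asm) nn_integral_0_iff_AE) auto
    then have "(\<integral>\<^sup>+ s. k (\<rho> / s) * h s \<partial>mult_haar) = 0" for \<rho>
      by (subst nn_integral_0_iff_AE) (auto elim!: eventually_mono)
    then show ?thesis by simp
  next
    case 3
    then show ?thesis by (simp add: K_def ennreal_top_mult)
  qed
qed

subsection \<open>Polar coordinates\<close>

lemma nn_integral_lborel_scaleR:
  fixes f :: "'a::euclidean_space \<Rightarrow> ennreal"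
  assumes [measurable]: "f \<in> borel_measurable borel" and c: "0 < c"
  shows "(\<integral>\<^sup>+ x. f x \<partial>lborel) = ennreal (c ^ DIM('a)) * (\<integral>\<^sup>+ x. f (c *\<^sub>R x) \<partial>lborel)"
  using c by (subst lborel_affine[of c 0])
    (simp_all add: nn_integral_density nn_integral_distr nn_integral_cmult)

lemma measurable_surface_measure [measurable (raw)]:
  assumes "f \<in> borel_measurable borel"
  shows "f \<in> borel_measurable (surface_measure :: 'a::euclidean_space measure)"
proof -
  have "f \<in> borel_measurable (restrict_space borel (sphere 0 1))"
    using assms by (rule measurable_restrict_space1)
  then show ?thesis
    by (simp add: measurable_cong_sets[OF sets_surface_measure refl])
qed

lemma measurable_scaleR_surface_measure [measurable]:
  "(\<lambda>(r, \<theta>). r *\<^sub>R \<theta>) \<in> mult_haar \<Otimes>\<^sub>M (surface_measure :: 'a::euclidean_space measure) \<rightarrow>\<^sub>M borel"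
proof -
  have [measurable]: "(\<lambda>\<theta>. \<theta>) \<in> borel_measurable (surface_measure :: 'a measure)"
    by (rule measurable_surface_measure) simp
  show ?thesis by measurable
qed

lemma measurable_sgn_euclidean [measurable (raw)]:
  fixes f :: "'b \<Rightarrow> 'a::euclidean_space"
  assumes [measurable]: "f \<in> borel_measurable M"
  shows "(\<lambda>x. sgn (f x)) \<in> borel_measurable M"
  unfolding sgn_div_norm by measurable

lemma nn_integral_surface_measure:
  fixes f :: "'a::euclidean_space \<Rightarrow> ennreal"
  assumes [measurable]: "f \<in> borel_measurable borel"
  shows "(\<integral>\<^sup>+ \<theta>. f \<theta> \<partial>surface_measure)
    = of_nat DIM('a) * (\<integral>\<^sup>+ y \<in> cball 0 1 - {0}. f (sgn y) \<partial>lborel)"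
proof -
  have [measurable]: "f \<in> borel_measurable (restrict_space borel (sphere 0 1))"
    by (rule measurable_restrict_space1) measurable
  show ?thesis
    unfolding surface_measure_def
    by (subst nn_integral_scale_measure)
      (simp_all add: nn_integral_distr[OF measurable_sgn_sphere] nn_integral_restrict_space)
qed

lemma finite_measure_surface_measure: "finite_measure (surface_measure :: 'a::euclidean_space measure)"
proof
  have "emeasure lborel {x :: 'a. 0 < norm x \<and> norm x \<le> 1 \<and> sgn x \<in> sphere 0 1}
      \<le> emeasure lborel (cball (0 :: 'a) 1)"
    by (intro emeasure_mono) auto
  also have "\<dots> < \<infinity>"
    by (rule emeasure_lborel_cball_finite)
  finally show "emeasure (surface_measure :: 'a measure) (space surface_measure) \<noteq> \<infinity>"
    by (simp add: space_surface_measure emeasure_surface_measure ennreal_mult_eq_top_iff)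
qed

interpretation surface_measure: finite_measure "surface_measure :: 'a::euclidean_space measure"
  by (rule finite_measure_surface_measure)

lemma emeasure_surface_measure_space:
  "emeasure (surface_measure :: 'a::euclidean_space measure) (space surface_measure)
    = ennreal (sphere_area TYPE('a))"
  by (simp add: sphere_area_def space_surface_measure surface_measure.emeasure_eq_measure)

lemma sphere_area_pos: "0 < sphere_area TYPE('a::euclidean_space)"
  by (simp add: sphere_area_eq)

text \<open>The density \<open>1 / s\<close> turns the integrand into N / s^(N + 1), with primitive
  -1 / s^N on the tail. In the polar coordinate formula the result cancels the factor
  \<open>norm z ^ N\<close>.\<close>

lemma nn_integral_mult_haar_tail:
  assumes "0 < N" "0 < a"
  shows "(\<integral>\<^sup>+ s. (if a \<le> s then ennreal (real N / s ^ N) else 0) \<partial>mult_haar) = ennreal (1 / a ^ N)"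
proof -
  obtain k where k: "N = Suc k" using assms(1) gr0_implies_Suc by blast
  have "(\<integral>\<^sup>+ s. (if a \<le> s then ennreal (real N / s ^ N) else 0) \<partial>mult_haar)
      = (\<integral>\<^sup>+ s \<in> {0<..}. (if a \<le> s then ennreal (real N / s ^ N) else 0) * ennreal (1 / s) \<partial>lborel)"
    by (rule nn_integral_mult_haar) measurable
  also have "\<dots> = (\<integral>\<^sup>+ s. ennreal (real N * inverse s ^ k * (inverse s)\<^sup>2 * indicator {0<..} s) * indicator {a..} s \<partial>lborel)"
  proof (rule nn_integral_cong)
    fix s :: real
    have "ennreal (real N / s ^ N) * ennreal (1 / s) = ennreal (real N * inverse s ^ k * (inverse s)\<^sup>2)" if "0 < s"
      using that by (simp add: k power2_eq_square field_simps flip: ennreal_mult)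
    then show "(if a \<le> s then ennreal (real N / s ^ N) else 0) * ennreal (1 / s) * indicator {0<..} s =
        ennreal (real N * inverse s ^ k * (inverse s)\<^sup>2 * indicator {0<..} s) * indicator {a..} s"
      by (auto simp: indicator_def)
  qed
  also have "\<dots> = ennreal (0 - (- (inverse a ^ N)))"
  proof (rule nn_integral_FTC_atLeast)
    show "((\<lambda>s. - (inverse s ^ N)) has_real_derivative
        real N * inverse x ^ k * (inverse x)\<^sup>2 * indicator {0<..} x) (at x)" if "a \<le> x" for x
      by (rule DERIV_cong[OF DERIV_minus[OF DERIV_power[OF DERIV_inverse]]])
        (use that assms in \<open>auto simp: k power2_eq_square mult_ac\<close>)
    have "((\<lambda>s::real. - (inverse s ^ N)) \<longlongrightarrow> - (0 ^ N)) at_top"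
      by (intro tendsto_intros tendsto_inverse_0_at_top filterlim_ident)
    then show "((\<lambda>s::real. - (inverse s ^ N)) \<longlongrightarrow> 0) at_top"
      by (simp add: k)
    show "0 \<le> real N * inverse x ^ k * (inverse x)\<^sup>2 * indicator {0<..} x" if "a \<le> x" for x
      using that assms by auto
  qed measurable
  finally show ?thesis by (simp add: inverse_eq_divide power_divide)
qed

text \<open>Three applications of Tonelli, separated by the dilations \<open>r = s |y|\<close> and \<open>z = s y\<close>: the surface
  measure is an integral over directions \<open>y / |y|\<close> of the unit ball, so no uniqueness theorem for
  measures is needed.\<close>

theorem nn_integral_polar:
  fixes f :: "'a::euclidean_space \<Rightarrow> ennreal"
  assumes [measurable]: "f \<in> borel_measurable borel"
  shows "(\<integral>\<^sup>+ x. f x \<partial>lborel)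
    = (\<integral>\<^sup>+ r. ennreal (r ^ DIM('a)) * (\<integral>\<^sup>+ \<theta>. f (r *\<^sub>R \<theta>) \<partial>surface_measure) \<partial>mult_haar)"
proof -
  define N where "N = DIM('a)"
  have N: "0 < N" by (simp add: N_def)
  interpret pair_sigma_finite mult_haar "lborel :: 'a measure" ..
  interpret Q: pair_sigma_finite "lborel :: 'a measure" mult_haar ..
  have AE_pos: "AE t in mult_haar. 0 < t" by (simp add: AE_mult_haar)
  have AE_nz: "AE y in lborel. y \<noteq> (0 :: 'a)" by (rule AE_lborel_singleton)
  define B :: "'a \<Rightarrow> ennreal" where "B = indicator (cball 0 1 - {0})"
  have [measurable]: "B \<in> borel_measurable borel" unfolding B_def by (intro borel_measurable_indicator) auto
  have "(\<integral>\<^sup>+ r. ennreal (r ^ N) * (\<integral>\<^sup>+ \<theta>. f (r *\<^sub>R \<theta>) \<partial>surface_measure) \<partial>mult_haar)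
     = (\<integral>\<^sup>+ r. (\<integral>\<^sup>+ y. of_nat N * (ennreal (r ^ N) * f (r *\<^sub>R sgn y) * B y) \<partial>lborel) \<partial>mult_haar)"
    by (simp add: nn_integral_surface_measure B_def[symmetric] N_def[symmetric]
      nn_integral_cmult[symmetric] mult_ac)
  also have "\<dots> = (\<integral>\<^sup>+ y. (\<integral>\<^sup>+ r. of_nat N * (ennreal (r ^ N) * f (r *\<^sub>R sgn y) * B y) \<partial>mult_haar) \<partial>lborel)"
    by (rule Q.Fubini') measurable
  also have "\<dots> = (\<integral>\<^sup>+ y. (\<integral>\<^sup>+ s. of_nat N * (ennreal ((norm y * s) ^ N) * f (s *\<^sub>R y) * B y) \<partial>mult_haar) \<partial>lborel)"
  proof (rule nn_integral_cong_AE, use AE_nz in eventually_elim)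
    case (elim y)
    then have "(norm y * s) *\<^sub>R sgn y = s *\<^sub>R y" for s
      by (simp add: sgn_div_norm)
    then show ?case
      using elim nn_integral_mult_haar_scale[of "\<lambda>r. of_nat N * (ennreal (r ^ N) * f (r *\<^sub>R sgn y) * B y)" "norm y"]
      by simp
  qed
  also have "\<dots> = (\<integral>\<^sup>+ s. (\<integral>\<^sup>+ y. of_nat N * (ennreal ((norm y * s) ^ N) * f (s *\<^sub>R y) * B y) \<partial>lborel) \<partial>mult_haar)"
    by (rule Fubini') measurable
  \<comment> \<open>Under z = s y the condition that y lies in the unit ball becomes
    \<open>norm z \<le> s\<close>, and the Jacobian s^(-N) is absorbed into the cutoff; the excluded
    origin is a null set.\<close>
  also have "\<dots> = (\<integral>\<^sup>+ s. (\<integral>\<^sup>+ z. ennreal (norm z ^ N) * f z * (if norm z \<le> s then ennreal (real N / s ^ N) else 0) \<partial>lborel) \<partial>mult_haar)"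
  proof (rule nn_integral_cong_AE, use AE_pos in eventually_elim)
    case (elim s)
    have "(\<integral>\<^sup>+ z. ennreal (norm z ^ N) * f z * (if norm z \<le> s then ennreal (real N / s ^ N) else 0) \<partial>lborel)
      = (\<integral>\<^sup>+ y. ennreal (s ^ N) * (ennreal (norm (s *\<^sub>R y) ^ N) * f (s *\<^sub>R y) * (if norm (s *\<^sub>R y) \<le> s then ennreal (real N / s ^ N) else 0)) \<partial>lborel)"
      using elim by (subst nn_integral_lborel_scaleR[of _ s])
        (simp_all add: N_def nn_integral_cmult del: norm_scaleR)
    also have "\<dots> = (\<integral>\<^sup>+ y. of_nat N * (ennreal ((norm y * s) ^ N) * f (s *\<^sub>R y) * B y) \<partial>lborel)"
    proof (rule nn_integral_cong_AE, use AE_nz in eventually_elim)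
      case y: (elim y)
      have "ennreal (s ^ N) * ennreal (real N / s ^ N) * (f (s *\<^sub>R y) * ennreal ((norm y * s) ^ N))
          = of_nat N * (f (s *\<^sub>R y) * ennreal ((norm y * s) ^ N))"
        using elim by (simp add: ennreal_of_nat_eq_real_of_nat flip: ennreal_mult)
      moreover have "norm (s *\<^sub>R y) \<le> s \<longleftrightarrow> B y = 1" "B y = 1 \<or> B y = 0"
        using elim y by (auto simp: B_def indicator_def)
      moreover have "norm (s *\<^sub>R y) = norm y * s"
        using elim by simp
      ultimately show ?case
        by (auto simp: mult_ac)
    qed
    finally show ?case ..
  qed
  also have "\<dots> = (\<integral>\<^sup>+ z. (\<integral>\<^sup>+ s. ennreal (norm z ^ N) * f z * (if norm z \<le> s then ennreal (real N / s ^ N) else 0) \<partial>mult_haar) \<partial>lborel)"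
    by (rule Q.Fubini') measurable
  also have "\<dots> = (\<integral>\<^sup>+ z. f z \<partial>lborel)"
  proof (rule nn_integral_cong_AE, use AE_nz in eventually_elim)
    case (elim z)
    have "ennreal (norm z ^ N) * ennreal (1 / norm z ^ N) = 1"
      using elim by (simp flip: ennreal_mult)
    then show ?case
      using elim N by (simp add: nn_integral_cmult nn_integral_mult_haar_tail)
        (metis mult.commute mult.left_commute mult_1_right)
  qed
  finally show ?thesis by (simp add: N_def)
qed

section \<open>Null sets in polar coordinates\<close>

lemma AE_lborel_polar_iff:
  fixes P :: "'a::euclidean_space \<Rightarrow> bool"
  assumes [measurable]: "Measurable.pred borel P"
  shows "(AE x in lborel. P x) \<longleftrightarrow> (AE r in mult_haar. AE \<theta> in surface_measure. P (r *\<^sub>R \<theta>))"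
proof -
  have "(AE x in lborel. P x) \<longleftrightarrow> (\<integral>\<^sup>+ x. indicator {x. \<not> P x} x \<partial>lborel) = 0"
    by (subst nn_integral_0_iff_AE) (auto simp: indicator_def intro!: AE_cong)
  also have "\<dots> \<longleftrightarrow> (AE r in mult_haar. ennreal (r ^ DIM('a)) *
      (\<integral>\<^sup>+ \<theta>. indicator {x. \<not> P x} (r *\<^sub>R \<theta> :: 'a) \<partial>surface_measure) = 0)"
    by (subst nn_integral_polar, measurable) (rule nn_integral_0_iff_AE, measurable)
  \<comment> \<open>The Jacobian is positive wherever \<open>mult_haar\<close> has mass, so the
    product vanishes only through the spherical integral.\<close>
  also have "\<dots> \<longleftrightarrow> (AE r in mult_haar. (\<integral>\<^sup>+ \<theta>. indicator {x. \<not> P x} (r *\<^sub>R \<theta> :: 'a) \<partial>surface_measure) = 0)"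
    unfolding AE_mult_haar by (intro AE_cong) (auto simp: ennreal_eq_0_iff power_le_zero_eq)
  also have "\<dots> \<longleftrightarrow> (AE r in mult_haar. AE \<theta> in surface_measure. P (r *\<^sub>R \<theta>))"
    by (intro AE_cong, subst nn_integral_0_iff_AE) (auto simp: indicator_def intro!: AE_cong)
  finally show ?thesis .
qed

text \<open>For a predicate not assumed measurable, a Borel null set containing its exceptional set
  takes the place of that set in the polar formula.\<close>

lemma AE_lborel_polarD:
  fixes P :: "'a::euclidean_space \<Rightarrow> bool"
  assumes "AE x in lborel. P x"
  shows "AE r in mult_haar. AE \<theta> in surface_measure. P (r *\<^sub>R \<theta>)"
proof -
  obtain N where N: "{x. \<not> P x} \<subseteq> N" "N \<in> sets borel" "emeasure lborel N = 0"
    using AE_E[OF assms] by auto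
  have [measurable]: "N \<in> sets borel" by fact
  have "AE x in lborel. x \<notin> N"
    using N by (auto intro!: AE_not_in simp: null_sets_def)
  then have "AE r in mult_haar. AE \<theta> in surface_measure. (r *\<^sub>R \<theta>) \<notin> N"
    by (subst (asm) AE_lborel_polar_iff) auto
  then show ?thesis
    using N(1) by (auto elim!: eventually_mono)
qed

text \<open>On the sphere of radius \<open>r\<close> the norm is constantly \<open>r\<close>, so a
  null set of radii has a null preimage under the norm. This carries almost-everywhere statements
  about radial profiles back to the whole space.\<close>

lemma AE_lborel_normI:
  assumes "AE r in mult_haar. P r"
  shows "AE x in lborel. P (norm (x :: 'a::euclidean_space))"
proof -
  obtain N where N: "{x. \<not> P x} \<subseteq> N" "N \<in> sets borel" "emeasure mult_haar N = 0"
    using AE_E[OF assms] by auto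
  have [measurable]: "N \<in> sets borel" by fact
  have "AE r in mult_haar. r \<notin> N"
    using N by (auto intro!: AE_not_in simp: null_sets_def)
  moreover have "AE r in mult_haar. 0 < r" by (simp add: AE_mult_haar)
  ultimately have "AE r in mult_haar. AE \<theta> in surface_measure. norm (r *\<^sub>R \<theta> :: 'a) \<notin> N"
    by eventually_elim (auto intro!: AE_I2 simp: space_surface_measure)
  then have "AE x in lborel. norm (x :: 'a) \<notin> N"
    by (subst AE_lborel_polar_iff) auto
  then show ?thesis
    using N(1) by (auto elim!: eventually_mono)
qed

subsection \<open>Hausdorff operators with radial kernel\<close>

text \<open>Restriction to rays and spheres can destroy Lebesgue measurability but keeps Borel
  measurability, so \<open>F\<close> and \<open>\<Phi>\<close> are first replaced by Borel
  functions, real and imaginary parts separately.\<close>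

lemma lebesgue_ex_borel_complex:
  fixes f :: "'a::euclidean_space \<Rightarrow> complex"
  assumes "f \<in> borel_measurable lebesgue"
  obtains f' where "f' \<in> borel_measurable borel" "AE x in lborel. f x = f' x"
proof -
  have "(\<lambda>x. Re (f x)) \<in> borel_measurable lebesgue" "(\<lambda>x. Im (f x)) \<in> borel_measurable lebesgue"
    using assms by (auto intro: measurable_compose[OF assms])
  then obtain u v where uv: "u \<in> borel_measurable lborel" "AE x in lborel. Re (f x) = u x"
      "v \<in> borel_measurable lborel" "AE x in lborel. Im (f x) = v x"
    by (blast dest: completion_ex_borel_measurable_real)
  show thesis
  proof
    show "(\<lambda>x. Complex (u x) (v x)) \<in> borel_measurable borel"
      using uv by (simp add: borel_measurable_complex_iff)
    show "AE x in lborel. f x = Complex (u x) (v x)"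
      using uv(2,4) by eventually_elim (simp add: complex_eq_iff)
  qed
qed

text \<open>Almost every ray meets an exceptional null set of \<open>\<Phi>\<close> in a null set, so a Borel version of the
  profile is found on a single ray.\<close>

lemma radial_value_ex_borel:
  fixes \<Phi> :: "'a::euclidean_space \<Rightarrow> complex"
  assumes "\<Phi> \<in> borel_measurable lebesgue" "radial \<Phi>"
  obtains \<phi> where "\<phi> \<in> borel_measurable borel" "AE t in mult_haar. radial_value \<Phi> t = \<phi> t"
proof -
  interpret pair_sigma_finite mult_haar "surface_measure :: 'a measure" ..
  obtain \<Psi> where [measurable]: "\<Psi> \<in> borel_measurable borel" and "AE x in lborel. \<Phi> x = \<Psi> x"
    using lebesgue_ex_borel_complex[OF assms(1)] by blast
  then obtain N where N: "{x. \<Phi> x \<noteq> \<Psi> x} \<subseteq> N" "N \<in> sets borel" "emeasure lborel N = 0"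
    by (auto elim!: AE_E)
  have [measurable]: "N \<in> sets borel" by fact
  have [measurable]: "(\<lambda>p. fst p *\<^sub>R snd p) \<in> mult_haar \<Otimes>\<^sub>M (surface_measure :: 'a measure) \<rightarrow>\<^sub>M borel"
    using measurable_scaleR_surface_measure by (simp add: case_prod_beta)
  have measurable_N: "{p \<in> space (mult_haar \<Otimes>\<^sub>M (surface_measure :: 'a measure)). fst p *\<^sub>R snd p \<notin> N}
      \<in> sets (mult_haar \<Otimes>\<^sub>M surface_measure)"
    by measurable
  have "AE x in lborel. x \<notin> N"
    using N by (auto intro!: AE_not_in simp: null_sets_def)
  then have "AE r in mult_haar. AE \<theta> in surface_measure. r *\<^sub>R \<theta> \<notin> N"
    by (rule AE_lborel_polarD)
  \<comment> \<open>Exchanging the two quantifiers is Tonelli for null sets and requires a jointly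
    measurable set, which the Borel set \<open>N\<close> provides.\<close>
  then have "AE \<theta> in surface_measure. AE r in mult_haar. r *\<^sub>R \<theta> \<notin> N"
    using AE_commute[OF measurable_N] by simp
  then have "AE \<theta> in surface_measure. norm \<theta> = 1 \<and> (AE r in mult_haar. r *\<^sub>R \<theta> \<notin> N)"
    using AE_space by eventually_elim (auto simp: space_surface_measure)
  \<comment> \<open>The sphere has positive area, so what holds for almost every direction holds for
    at least one.\<close>
  moreover have "ae_filter (surface_measure :: 'a measure) \<noteq> bot"
    using sphere_area_pos[where 'a = 'a]
    by (auto simp: ae_filter_eq_bot_iff emeasure_surface_measure_space)
  ultimately obtain \<theta> where \<theta>: "norm \<theta> = 1" "AE r in mult_haar. r *\<^sub>R \<theta> \<notin> N"
    using eventually_happens' by blast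
  show thesis
  proof
    show "(\<lambda>r. \<Psi> (r *\<^sub>R \<theta>)) \<in> borel_measurable borel" by measurable
    have "AE r in mult_haar. 0 < r" by (simp add: AE_mult_haar)
    with \<theta>(2) show "AE r in mult_haar. radial_value \<Phi> r = \<Psi> (r *\<^sub>R \<theta>)"
    proof eventually_elim
      case (elim r)
      then show ?case
        using N(1) radial_value_norm[OF assms(2), of "r *\<^sub>R \<theta>"] \<theta>(1) by auto
    qed
  qed
qed

section \<open>Mixed norms and integrals over spheres\<close>

lemma rad_ang_norm_cong_AE:
  fixes F F' :: "'a::euclidean_space \<Rightarrow> complex"
  assumes "AE x in lborel. F x = F' x"
  shows "rad_ang_norm p q w F = rad_ang_norm p q w F'"
proof -
  have "AE r in lborel. 0 < r \<longrightarrow> (AE \<theta> in surface_measure. F (r *\<^sub>R \<theta>) = F' (r *\<^sub>R \<theta>))"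
    using AE_lborel_polarD[OF assms] by (simp add: AE_mult_haar)
  then have "AE r in lborel. 0 < r \<longrightarrow>
      (\<integral>\<^sup>+ \<theta>. ennreal (cmod (F (r *\<^sub>R \<theta>)) powr q) \<partial>surface_measure)
        = (\<integral>\<^sup>+ \<theta>. ennreal (cmod (F' (r *\<^sub>R \<theta>)) powr q) \<partial>surface_measure)"
  proof eventually_elim
    case (elim r)
    show ?case
    proof
      assume "0 < r"
      with elim have "AE \<theta> in surface_measure. F (r *\<^sub>R \<theta>) = F' (r *\<^sub>R \<theta>)" by simp
      then show "(\<integral>\<^sup>+ \<theta>. ennreal (cmod (F (r *\<^sub>R \<theta>)) powr q) \<partial>surface_measure)
        = (\<integral>\<^sup>+ \<theta>. ennreal (cmod (F' (r *\<^sub>R \<theta>)) powr q) \<partial>surface_measure)"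
        by (intro nn_integral_cong_AE) (auto elim!: eventually_mono)
    qed
  qed
  then show ?thesis
    unfolding rad_ang_norm_def
    by (intro arg_cong2[where f = ennpowr] refl nn_integral_cong_AE, elim eventually_mono)
      (simp add: indicator_def)
qed

text \<open>The radial density r^(N - 1) dr equals r^N dr/r, which puts the norm in the form
  required by the convolution inequality.\<close>

lemma rad_ang_norm_mult_haar:
  fixes F :: "'a::euclidean_space \<Rightarrow> complex"
  assumes [measurable]: "F \<in> borel_measurable borel"
  shows "rad_ang_norm p q (\<lambda>r. 1) F = ennpowr (\<integral>\<^sup>+ r.
    ennpowr (\<integral>\<^sup>+ \<theta>. ennreal (cmod (F (r *\<^sub>R \<theta>)) powr q) \<partial>surface_measure) (p / q)
      * ennreal (r ^ DIM('a)) \<partial>mult_haar) (1 / p)"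
proof -
  have "ennreal (r ^ (DIM('a) - 1)) = ennreal (r ^ DIM('a)) * ennreal (1 / r)" if "0 < r" for r :: real
    using that by (simp add: power_diff flip: ennreal_mult)
  then show ?thesis
    unfolding rad_ang_norm_def
    by (subst nn_integral_mult_haar, measurable)
      (auto intro!: arg_cong2[where f = ennpowr] nn_integral_cong simp: indicator_def mult.assoc)
qed

text \<open>Jensen's inequality on the sphere, followed by a q-th root, turns the area exponent
  \<open>q - 1\<close> into \<open>1 - 1 / q\<close>, the reciprocal of the conjugate exponent.
  Written this way, the bound includes \<open>q = 1\<close>, where the area factor is 1.\<close>

lemma nn_integral_sphere_Holder:
  fixes F :: "'a::euclidean_space \<Rightarrow> complex"
  assumes [measurable]: "F \<in> borel_measurable borel" and q: "1 \<le> q"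
  shows "(\<integral>\<^sup>+ \<theta>. ennreal (cmod (F (r *\<^sub>R \<theta>))) \<partial>surface_measure)
    \<le> ennreal (sphere_area TYPE('a) powr (1 - 1 / q))
      * ennpowr (\<integral>\<^sup>+ \<theta>. ennreal (cmod (F (r *\<^sub>R \<theta>)) powr q) \<partial>surface_measure) (1 / q)"
proof -
  define G where "G = (\<integral>\<^sup>+ \<theta>. ennreal (cmod (F (r *\<^sub>R \<theta>))) \<partial>surface_measure)"
  have "ennpowr G q \<le> ennpowr (ennreal (sphere_area TYPE('a))) (q - 1)
      * (\<integral>\<^sup>+ \<theta>. ennreal (cmod (F (r *\<^sub>R \<theta>)) powr q) \<partial>surface_measure)"
    using nn_integral_power_mean[of "\<lambda>\<theta>. ennreal (cmod (F (r *\<^sub>R \<theta>)))" "surface_measure :: 'a measure" q] q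
    by (simp add: G_def emeasure_surface_measure_space ennpowr_ennreal)
  then have "ennpowr (ennpowr G q) (1 / q) \<le> ennpowr (ennpowr (ennreal (sphere_area TYPE('a))) (q - 1)
      * (\<integral>\<^sup>+ \<theta>. ennreal (cmod (F (r *\<^sub>R \<theta>)) powr q) \<partial>surface_measure)) (1 / q)"
    using q by (intro ennpowr_mono) auto
  moreover have "(q - 1) * (1 / q) = 1 - 1 / q" "q * (1 / q) = 1"
    using q by (simp_all add: field_simps)
  ultimately show ?thesis
    using q sphere_area_pos[where 'a = 'a]
    by (simp add: ennpowr_ennpowr ennpowr_mult ennpowr_ennreal powr_powr G_def[symmetric] del: times_divide_eq_right)
qed

section \<open>Reduction of the operator to a multiplicative convolution\<close>

lemma hausdorff_integrand_radial:
  fixes \<Phi> :: "'a::euclidean_space \<Rightarrow> complex" and F :: "'b::euclidean_space \<Rightarrow> complex"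
  assumes "radial \<Phi>" and \<phi>: "AE t in mult_haar. radial_value \<Phi> t = \<phi> t"
    and F': "AE y in lborel. F y = F' y" and x: "x \<noteq> 0"
  shows "AE y in lborel. hausdorff_integrand \<Phi> F x y
    = \<phi> (norm x / norm y) / of_real (norm y ^ DIM('b)) * F' y"
proof -
  \<comment> \<open>The exceptional radii of the profile stay null under the inversion t -> |x| / t,
    and then under pulling back by the norm.\<close>
  have "AE y in lborel. radial_value \<Phi> (norm x / norm (y :: 'b)) = \<phi> (norm x / norm y)"
    by (rule AE_lborel_normI[OF AE_mult_haar_divide[OF \<phi>]]) (use x in simp)
  with F' show ?thesis
  proof eventually_elim
    case (elim y)
    then show ?case
      using radial_value_norm[OF assms(1), of "x /\<^sub>R norm y"]
      by (simp add: hausdorff_integrand_def divide_inverse mult.commute)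
  qed
qed

text \<open>The Jacobian of polar coordinates cancels the homogeneous factor of the kernel, and the
  profile is constant on each sphere, so only the plain spherical integral of |F| remains.\<close>

lemma nn_integral_radial_kernel:
  fixes F :: "'b::euclidean_space \<Rightarrow> complex" and \<phi> :: "real \<Rightarrow> complex"
  assumes [measurable]: "F \<in> borel_measurable borel" "\<phi> \<in> borel_measurable borel"
  shows "(\<integral>\<^sup>+ y. ennreal (cmod (\<phi> (\<rho> / norm y) / of_real (norm y ^ DIM('b)) * F y)) \<partial>lborel)
    = (\<integral>\<^sup>+ s. ennreal (cmod (\<phi> (\<rho> / s)))
        * (\<integral>\<^sup>+ \<theta>. ennreal (cmod (F (s *\<^sub>R \<theta>))) \<partial>surface_measure) \<partial>mult_haar)"
proof -
  have AE_pos: "AE t in mult_haar. 0 < t" by (simp add: AE_mult_haar)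
  have "(\<integral>\<^sup>+ y. ennreal (cmod (\<phi> (\<rho> / norm y) / of_real (norm y ^ DIM('b)) * F y)) \<partial>lborel)
    = (\<integral>\<^sup>+ s. ennreal (s ^ DIM('b)) * (\<integral>\<^sup>+ \<theta>. ennreal (cmod (\<phi> (\<rho> / norm (s *\<^sub>R \<theta>))
        / of_real (norm (s *\<^sub>R \<theta>) ^ DIM('b)) * F (s *\<^sub>R \<theta>))) \<partial>surface_measure) \<partial>mult_haar)"
    by (rule nn_integral_polar) measurable
  also have "\<dots> = (\<integral>\<^sup>+ s. ennreal (cmod (\<phi> (\<rho> / s)))
        * (\<integral>\<^sup>+ \<theta>. ennreal (cmod (F (s *\<^sub>R \<theta>))) \<partial>surface_measure) \<partial>mult_haar)"
  proof (rule nn_integral_cong_AE, use AE_pos in eventually_elim)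
    case (elim s)
    show ?case
    proof (subst (1 2) nn_integral_cmult[symmetric], measurable, rule nn_integral_cong)
      fix \<theta> :: 'b
      assume "\<theta> \<in> space surface_measure"
      then have "norm \<theta> = 1" by (simp add: space_surface_measure)
      then show "ennreal (s ^ DIM('b)) * ennreal (cmod (\<phi> (\<rho> / norm (s *\<^sub>R \<theta>))
          / of_real (norm (s *\<^sub>R \<theta>) ^ DIM('b)) * F (s *\<^sub>R \<theta>)))
        = ennreal (cmod (\<phi> (\<rho> / s))) * ennreal (cmod (F (s *\<^sub>R \<theta>)))"
        using elim by (simp add: norm_mult norm_divide norm_power flip: ennreal_mult)
    qed
  qed
  finally show ?thesis .
qed

text \<open>The two spaces enter only through their dimensions, and the weight exponent is the
  difference of these. The integrability claim shows that for a finite constant the operator is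
  given almost everywhere by a convergent integral, and not by the default value 0 of a divergent
  one.\<close>

theorem hausdorff_op_rad_ang_norm:
  fixes \<Phi> :: "'a::euclidean_space \<Rightarrow> complex" and F :: "'b::euclidean_space \<Rightarrow> complex"
  assumes p: "1 \<le> p" "1 \<le> p1" "1 \<le> p2"
    and \<beta>: "\<beta> = real DIM('b) - real DIM('a)"
    and \<Phi>: "\<Phi> \<in> borel_measurable lebesgue" "radial \<Phi>"
    and F: "F \<in> rad_ang_space p p2 (\<lambda>r. 1)"
  shows hausdorff_integrand_integrable: "hausdorff_const \<Phi> (DIM('b) / p) < \<infinity> \<Longrightarrow>
            AE x in lebesgue. integrable lebesgue (hausdorff_integrand \<Phi> F x)"
       and hausdorff_op_bound: "rad_ang_norm p p1 (\<lambda>r. r powr \<beta>) (hausdorff_op \<Phi> F)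
         \<le> ennreal (sphere_area TYPE('a) powr (1 / p1))
           * ennreal (sphere_area TYPE('b) powr (1 - 1 / p2))
           * hausdorff_const \<Phi> (DIM('b) / p)
           * rad_ang_norm p p2 (\<lambda>r. 1) F"
proof -
  \<comment> \<open>This exponent makes the p-th power of s^a equal to the Jacobian s^N of the
    domain, so the weights can be moved inside the p-th powers.\<close>
  define a where "a = real DIM('b) / p"
  obtain F' where F'_meas [measurable]: "F' \<in> borel_measurable borel" and F': "AE y in lborel. F y = F' y"
    using F lebesgue_ex_borel_complex[of F] by (auto simp: rad_ang_space_def)
  obtain \<phi> where \<phi>_meas [measurable]: "\<phi> \<in> borel_measurable borel"
    and \<phi>: "AE t in mult_haar. radial_value \<Phi> t = \<phi> t"
    using radial_value_ex_borel[OF \<Phi>] by blast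
  have AE_pos: "AE t in mult_haar. 0 < t" by (simp add: AE_mult_haar)
  have powr_a: "ennpowr (ennreal (t powr a)) p = ennreal (t ^ DIM('b))" if "0 < t" for t
    using that p by (simp add: ennpowr_ennreal powr_powr a_def powr_realpow)

  define G where "G s = (\<integral>\<^sup>+ \<theta>. ennreal (cmod (F' (s *\<^sub>R \<theta>))) \<partial>surface_measure)" for s
  define g where "g \<rho> = (\<integral>\<^sup>+ s. ennreal (cmod (\<phi> (\<rho> / s))) * G s \<partial>mult_haar)" for \<rho>
  have [measurable]: "G \<in> borel_measurable borel" "g \<in> borel_measurable borel"
    unfolding G_def g_def by measurable
  define K where "K = hausdorff_const \<Phi> a"
  have K: "K = (\<integral>\<^sup>+ t. ennreal (cmod (\<phi> t) * t powr a) \<partial>mult_haar)"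
  proof -
    have *: "AE t in lborel. 0 < t \<longrightarrow> radial_value \<Phi> t = \<phi> t"
      using \<phi> by (simp add: AE_mult_haar)
    have "K = (\<integral>\<^sup>+ t \<in> {0<..}. ennreal (cmod (\<phi> t) * t powr a) * ennreal (1 / t) \<partial>lborel)"
      unfolding K_def hausdorff_const_def
      by (rule nn_integral_cong_AE, use * in eventually_elim)
        (auto simp: indicator_def simp flip: ennreal_mult)
    also have "\<dots> = (\<integral>\<^sup>+ t. ennreal (cmod (\<phi> t) * t powr a) \<partial>mult_haar)"
      by (rule nn_integral_mult_haar[symmetric]) measurable
    finally show ?thesis .
  qed
  define S where "S r = (\<integral>\<^sup>+ \<theta>. ennreal (cmod (F' (r *\<^sub>R \<theta>)) powr p2) \<partial>surface_measure)" for r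
  have [measurable]: "S \<in> borel_measurable borel"
    unfolding S_def by measurable
  define J where "J = (\<integral>\<^sup>+ r. ennpowr (S r) (p / p2) * ennreal (r ^ DIM('b)) \<partial>mult_haar)"
  have norm_F: "rad_ang_norm p p2 (\<lambda>r. 1) F = ennpowr J (1 / p)"
    using rad_ang_norm_cong_AE[OF F'] by (simp add: rad_ang_norm_mult_haar J_def S_def)
  define B where "B = ennreal (sphere_area TYPE('b) powr (1 - 1 / p2))"

  \<comment> \<open>Writing \<rho>^a as (\<rho>/s)^a s^a distributes the weight over kernel and
    function and exhibits a convolution.\<close>
  have "(\<integral>\<^sup>+ \<rho>. ennpowr (g \<rho> * ennreal (\<rho> powr a)) p \<partial>mult_haar)
      = (\<integral>\<^sup>+ \<rho>. ennpowr (\<integral>\<^sup>+ s. ennreal (cmod (\<phi> (\<rho> / s)) * (\<rho> / s) powr a) * (G s * ennreal (s powr a)) \<partial>mult_haar) p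
          \<partial>mult_haar)"
  proof (rule nn_integral_cong_AE, use AE_pos in eventually_elim)
    case (elim \<rho>)
    have "g \<rho> * ennreal (\<rho> powr a)
        = (\<integral>\<^sup>+ s. ennreal (cmod (\<phi> (\<rho> / s)) * (\<rho> / s) powr a) * (G s * ennreal (s powr a)) \<partial>mult_haar)"
      unfolding g_def
    proof (subst nn_integral_multc[symmetric], measurable,
        rule nn_integral_cong_AE, use AE_pos in eventually_elim)
      case s: (elim s)
      then have "(\<rho> / s) powr a * s powr a = \<rho> powr a"
        using elim by (simp flip: powr_mult)
      then have "ennreal ((\<rho> / s) powr a) * ennreal (s powr a) = ennreal (\<rho> powr a)"
        by (simp flip: ennreal_mult)
      then show ?case
        by (simp add: ennreal_mult mult_ac)
    qed
    then show ?case by simp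
  qed
  also have "\<dots> \<le> ennpowr K p * (\<integral>\<^sup>+ s. ennpowr (G s * ennreal (s powr a)) p \<partial>mult_haar)"
    unfolding K using p by (intro nn_integral_mult_haar_convolution) auto
  also have "(\<integral>\<^sup>+ s. ennpowr (G s * ennreal (s powr a)) p \<partial>mult_haar)
      \<le> (\<integral>\<^sup>+ s. ennpowr B p * (ennpowr (S s) (p / p2) * ennreal (s ^ DIM('b))) \<partial>mult_haar)"
  proof (rule nn_integral_mono_AE, use AE_pos in eventually_elim)
    case (elim s)
    have "ennpowr (G s * ennreal (s powr a)) p
        \<le> ennpowr (B * ennpowr (S s) (1 / p2) * ennreal (s powr a)) p"
      using p nn_integral_sphere_Holder[of F' p2 s]
      by (intro ennpowr_mono mult_right_mono) (auto simp: G_def S_def B_def)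
    also have "\<dots> = ennpowr B p * (ennpowr (S s) (p / p2) * ennreal (s ^ DIM('b)))"
      using elim by (simp add: ennpowr_mult ennpowr_ennpowr powr_a mult.assoc)
    finally show ?case .
  qed
  also have "\<dots> = ennpowr B p * J"
    by (simp add: nn_integral_cmult J_def)
  finally have g_bound: "(\<integral>\<^sup>+ \<rho>. ennpowr (g \<rho> * ennreal (\<rho> powr a)) p \<partial>mult_haar)
      \<le> ennpowr K p * (ennpowr B p * J)"
    by (simp add: mult_left_mono)

  have kernel: "AE y in lborel. hausdorff_integrand \<Phi> F x y
      = \<phi> (norm x / norm y) / of_real (norm y ^ DIM('b)) * F' y" if "x \<noteq> 0" for x
    by (rule hausdorff_integrand_radial[OF \<Phi>(2) \<phi> F' that])
  have kernel_norm: "(\<integral>\<^sup>+ y. ennreal (cmod (hausdorff_integrand \<Phi> F x y)) \<partial>lebesgue) = g (norm x)"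
    if "x \<noteq> 0" for x
  proof -
    have "(\<integral>\<^sup>+ y. ennreal (cmod (hausdorff_integrand \<Phi> F x y)) \<partial>lebesgue)
      = (\<integral>\<^sup>+ y. ennreal (cmod (\<phi> (norm x / norm y) / of_real (norm y ^ DIM('b)) * F' y)) \<partial>lborel)"
      unfolding nn_integral_completion
      by (rule nn_integral_cong_AE, use kernel[OF that] in eventually_elim) simp
    also have "\<dots> = g (norm x)"
      unfolding g_def G_def by (rule nn_integral_radial_kernel) measurable
    finally show ?thesis .
  qed
  \<comment> \<open>Where the integrand is not integrable the operator takes the default value 0, so
    the bound persists.\<close>
  have op_le: "ennreal (cmod (hausdorff_op \<Phi> F x)) \<le> g (norm x)" if "x \<noteq> 0" for x
  proof (cases "integrable lebesgue (hausdorff_integrand \<Phi> F x)")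
    case True
    then show ?thesis
      using integral_norm_bound_ennreal[OF True] kernel_norm[OF that] by (simp add: hausdorff_op_def)
  next
    case False
    then show ?thesis
      by (simp add: hausdorff_op_def not_integrable_integral_eq)
  qed

  show "AE x in lebesgue. integrable lebesgue (hausdorff_integrand \<Phi> F x)"
    if "hausdorff_const \<Phi> (DIM('b) / p) < \<infinity>"
  proof -
    have "J < \<infinity>"
      using F by (simp add: rad_ang_space_def norm_F less_top[symmetric])
    then have "(\<integral>\<^sup>+ \<rho>. ennpowr (g \<rho> * ennreal (\<rho> powr a)) p \<partial>mult_haar) \<noteq> \<infinity>"
      using g_bound that by (auto simp: K_def a_def B_def ennpowr_ennreal ennreal_mult_eq_top_iff top_unique)
    then have "AE \<rho> in mult_haar. ennpowr (g \<rho> * ennreal (\<rho> powr a)) p \<noteq> \<infinity>"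
      by (intro nn_integral_noteq_infinite) auto
    with AE_pos have "AE \<rho> in mult_haar. g \<rho> < \<infinity>"
      by eventually_elim (auto simp: ennreal_mult_eq_top_iff less_top)
    then have "AE x in lborel. g (norm (x :: 'a)) < \<infinity>"
      by (rule AE_lborel_normI)
    moreover have "AE x in lborel. x \<noteq> (0 :: 'a)" by (rule AE_lborel_singleton)
    ultimately have "AE x in lborel. integrable lebesgue (hausdorff_integrand \<Phi> F x)"
    proof eventually_elim
      case (elim x)
      \<comment> \<open>Measurability of the integrand in \<open>y\<close> comes from its Borel
        version, since Lebesgue measure is complete.\<close>
      have "(\<lambda>y. \<phi> (norm x / norm y) / of_real (norm y ^ DIM('b)) * F' y) \<in> borel_measurable lebesgue"
        by (rule measurable_completion) measurable
      then have "hausdorff_integrand \<Phi> F x \<in> borel_measurable lebesgue"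
        by (rule borel_measurable_AE) (use AE_completion[OF kernel[OF elim(2)]] in \<open>auto elim!: eventually_mono\<close>)
      then show ?case
        using elim kernel_norm by (simp add: integrable_iff_bounded)
    qed
    then show ?thesis by (rule AE_completion)
  qed

  define A where "A = sphere_area TYPE('a)"
  have A: "0 < A" unfolding A_def by (rule sphere_area_pos)
  have "(\<integral>\<^sup>+ r \<in> {0<..}.
          ennpowr (\<integral>\<^sup>+ \<theta>. ennreal (cmod (hausdorff_op \<Phi> F (r *\<^sub>R \<theta>)) powr p1) \<partial>surface_measure) (p / p1)
          * ennreal (r ^ (DIM('a) - 1) * r powr \<beta>) \<partial>lborel)
      \<le> (\<integral>\<^sup>+ r \<in> {0<..}. ennreal (A powr (p / p1)) * ennpowr (g r * ennreal (r powr a)) p * ennreal (1 / r) \<partial>lborel)"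
  proof (rule nn_integral_mono)
    fix r :: real
    have "ennpowr (\<integral>\<^sup>+ \<theta>. ennreal (cmod (hausdorff_op \<Phi> F (r *\<^sub>R \<theta>)) powr p1) \<partial>surface_measure) (p / p1)
          * ennreal (r ^ (DIM('a) - 1) * r powr \<beta>)
      \<le> ennreal (A powr (p / p1)) * ennpowr (g r * ennreal (r powr a)) p * ennreal (1 / r)" if r: "0 < r"
    proof -
      \<comment> \<open>The majorant is constant on the sphere of radius \<open>r\<close>;
        integrating it over the angle yields the area \<open>A\<close>, whose power
        \<open>p / p1\<close> becomes \<open>1 / p1\<close> after the p-th root.\<close>
      have "(\<integral>\<^sup>+ \<theta>. ennreal (cmod (hausdorff_op \<Phi> F (r *\<^sub>R \<theta>)) powr p1) \<partial>surface_measure)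
          \<le> (\<integral>\<^sup>+ \<theta>. ennpowr (g r) p1 \<partial>(surface_measure :: 'a measure))"
      proof (rule nn_integral_mono)
        fix \<theta> :: 'a
        assume "\<theta> \<in> space surface_measure"
        then have "norm (r *\<^sub>R \<theta>) = r" "r *\<^sub>R \<theta> \<noteq> 0"
          using r by (auto simp: space_surface_measure)
        then have "ennpowr (ennreal (cmod (hausdorff_op \<Phi> F (r *\<^sub>R \<theta>)))) p1 \<le> ennpowr (g r) p1"
          using op_le[of "r *\<^sub>R \<theta>"] p by (intro ennpowr_mono) simp_all
        then show "ennreal (cmod (hausdorff_op \<Phi> F (r *\<^sub>R \<theta>)) powr p1) \<le> ennpowr (g r) p1"
          by (simp add: ennpowr_ennreal)
      qed
      also have "\<dots> = ennpowr (g r) p1 * ennreal A"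
        by (simp add: emeasure_surface_measure_space A_def)
      finally have "ennpowr (\<integral>\<^sup>+ \<theta>. ennreal (cmod (hausdorff_op \<Phi> F (r *\<^sub>R \<theta>)) powr p1) \<partial>surface_measure) (p / p1)
          \<le> ennpowr (ennpowr (g r) p1 * ennreal A) (p / p1)"
        using p by (intro ennpowr_mono) auto
      also have "\<dots> = ennreal (A powr (p / p1)) * ennpowr (g r) p"
        using p A by (simp add: ennpowr_mult ennpowr_ennpowr ennpowr_ennreal mult.commute)
      finally have le: "ennpowr (\<integral>\<^sup>+ \<theta>. ennreal (cmod (hausdorff_op \<Phi> F (r *\<^sub>R \<theta>)) powr p1) \<partial>surface_measure) (p / p1)
          \<le> ennreal (A powr (p / p1)) * ennpowr (g r) p" .
      \<comment> \<open>The weight raises the radial density of the target to that of the domain,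
        which is the p-th power of \<open>r powr a\<close> times the Haar density
        \<open>1 / r\<close>.\<close>
      have "r ^ (DIM('a) - 1) * r powr \<beta> = r powr (real (DIM('a) - 1) + \<beta>)"
        using r by (simp add: powr_add powr_realpow del: of_nat_diff)
      also have "real (DIM('a) - 1) + \<beta> = real DIM('b) - 1"
        by (simp add: \<beta> of_nat_diff)
      also have "r powr (real DIM('b) - 1) = r ^ DIM('b) * (1 / r)"
        using r by (simp add: powr_diff powr_realpow)
      finally have weight: "ennreal (r ^ (DIM('a) - 1) * r powr \<beta>) = ennpowr (ennreal (r powr a)) p * ennreal (1 / r)"
        using r by (simp add: powr_a flip: ennreal_mult)
      show ?thesis
        using mult_right_mono[OF le, of "ennreal (r ^ (DIM('a) - 1) * r powr \<beta>)"]
        unfolding weight by (simp add: ennpowr_mult mult.assoc)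
    qed
    then show "ennpowr (\<integral>\<^sup>+ \<theta>. ennreal (cmod (hausdorff_op \<Phi> F (r *\<^sub>R \<theta>)) powr p1) \<partial>surface_measure) (p / p1)
          * ennreal (r ^ (DIM('a) - 1) * r powr \<beta>) * indicator {0<..} r
      \<le> ennreal (A powr (p / p1)) * ennpowr (g r * ennreal (r powr a)) p * ennreal (1 / r) * indicator {0<..} r"
      by (simp add: indicator_def)
  qed
  also have "\<dots> = (\<integral>\<^sup>+ r. ennreal (A powr (p / p1)) * ennpowr (g r * ennreal (r powr a)) p \<partial>mult_haar)"
    by (rule nn_integral_mult_haar[symmetric]) measurable
  also have "\<dots> = ennreal (A powr (p / p1)) * (\<integral>\<^sup>+ r. ennpowr (g r * ennreal (r powr a)) p \<partial>mult_haar)"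
    by (rule nn_integral_cmult) measurable
  also have "\<dots> \<le> ennreal (A powr (p / p1)) * (ennpowr K p * (ennpowr B p * J))"
    by (intro mult_left_mono g_bound) auto
  finally have "rad_ang_norm p p1 (\<lambda>r. r powr \<beta>) (hausdorff_op \<Phi> F)
      \<le> ennpowr (ennreal (A powr (p / p1)) * (ennpowr K p * (ennpowr B p * J))) (1 / p)"
    unfolding rad_ang_norm_def using p by (intro ennpowr_mono) auto
  also have "\<dots> = ennreal (A powr (1 / p1)) * (K * (B * ennpowr J (1 / p)))"
    using p by (simp add: ennpowr_mult ennpowr_ennpowr ennpowr_ennreal powr_powr)
  finally show "rad_ang_norm p p1 (\<lambda>r. r powr \<beta>) (hausdorff_op \<Phi> F)
         \<le> ennreal (sphere_area TYPE('a) powr (1 / p1))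
           * ennreal (sphere_area TYPE('b) powr (1 - 1 / p2))
           * hausdorff_const \<Phi> (DIM('b) / p)
           * rad_ang_norm p p2 (\<lambda>r. 1) F"
    by (simp add: norm_F A_def B_def K_def a_def mult_ac)
qed

text \<open>The space of dimension nm is modelled by an index type with \<open>n * m\<close>
  elements, and \<open>1 - 1 / p2\<close> is the reciprocal of the conjugate exponent of
  \<open>p2\<close>.\<close>

theorem theorem1p3:
  fixes n m :: nat
    and p p1 p2 \<beta> :: real
    and \<Phi> :: "real ^ 'n \<Rightarrow> complex"
    and F :: "real ^ 'd \<Rightarrow> complex"
  assumes "n \<ge> 2" and "m \<ge> 1"
    and "CARD('n) = n" and "CARD('d) = n * m"
    and "1 \<le> p" and "1 \<le> p1" and "1 \<le> p2"
    and "\<beta> = real n * (real m - 1)"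
    and "\<Phi> \<in> borel_measurable lebesgue" and "radial \<Phi>"
    and "F \<in> rad_ang_space p p2 (\<lambda>r. 1)"
  shows "(hausdorff_const \<Phi> (real (n * m) / p) < \<infinity> \<longrightarrow>
            (AE x in lebesgue. integrable lebesgue (hausdorff_integrand \<Phi> F x)))
       \<and> rad_ang_norm p p1 (\<lambda>r. r powr \<beta>) (hausdorff_op \<Phi> F)
         \<le> ennreal (sphere_area TYPE(real ^ 'n) powr (1 / p1))
           * ennreal (sphere_area TYPE(real ^ 'd) powr (1 - 1 / p2))
           * hausdorff_const \<Phi> (real (n * m) / p)
           * rad_ang_norm p p2 (\<lambda>r. 1) F"
proof -
  have dims: "DIM(real ^ 'n) = n" "DIM(real ^ 'd) = n * m"
    using assms by simp_all
  \<comment> \<open>Here n (m - 1) = nm - n is recognized as the difference of the two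
    dimensions.\<close>
  have "\<beta> = real DIM(real ^ 'd) - real DIM(real ^ 'n)"
    unfolding dims using assms by (simp add: algebra_simps)
  from hausdorff_integrand_integrable[OF assms(5-7) this assms(9-11)]
    hausdorff_op_bound[OF assms(5-7) this assms(9-11)]
  show ?thesis
    unfolding dims by blast
qed

end
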